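(* Let $V$ be a real inner product space, let $S\subset V$ be a sphere with center $c\in V$ and radius $r>0$, let $p,q\in S$, and let $C:[a,b]\to V$ (with $a<b$) be a continuous curve with $C(a)=p$, $C(b)=q$ and $C([a,b])\subset S$, such that $\ell(C_{st})>0$ whenever $a\le s<t\le b$. If $C$ is not the minor arc from $p$ to $q$ of a great circle of $S$, then $C$ is not a geodesic from $p$ to $q$.
   Context: The distance on $V$ is $d(x,y)=\|x-y\|$, induced by the inner product; $V$ may have any dimension (including infinite). The sphere is $S=\{x\in V: d(x,c)=r\}$. The length of a continuous curve $C:[a,b]\to V$ is $\ell(C)=\sup\sum_{i=0}^n d(C(t_i),C(t_{i+1}))\in[0,\infty]$, the supremum being over all finite partitions $a=t_0<t_1<\cdots<t_n<t_{n+1}=b$ of $[a,b]$. For $a\le s\le t\le b$, $C_{st}$ denotes the restriction of $C$ to $[s,t]$. A great circle of $S$ is the intersection of $S$ with a two-dimensional affine plane through $c$. A curve $C:[a,b]\to V$ is (a parametrization of) the minor arc from $p$ to $q$ of a great circle if there exist a unit vector $u\in V$ orthogonal to $p-c$, a number $\omega\in[0,\pi]$, and a continuous nondecreasing surjection $\theta:[a,b]\to[0,\omega]$ such that $C(t)=c+\cos(\theta(t))\,(p-c)+r\sin(\theta(t))\,u$ for all $t\in[a,b]$ and $C(b)=q$. (If $p,q$ are distinct and not antipodal, the arc is unique as a set; if they are antipodal, any half great circle from $p$ to $q$ counts as a minor arc.) A curve from $p$ to $q$ on $S$ is a continuous curve defined on a compact interval, with initial point $p$, final point $q$ and image contained in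 $S$. Such a curve $G$ is called a geodesic from $p$ to $q$ when $\ell(G)\le\ell(D)$ for every continuous curve $D$ (defined on any compact interval) from $p$ to $q$ with image contained in $S$. *)

theory Defs
  imports "HOL-Analysis.Analysis"
begin

text \<open>A curve is given by a function on the reals together with the endpoints of its parameter
  interval, so the restriction \<open>C\<^sub>s\<^sub>t\<close> is \<open>C\<close> on \<open>{s..t}\<close> and its length is \<open>curve_length C s t\<close>.
  For \<open>a = b\<close> there is no strictly increasing partition, and the supremum of the empty set in
  \<^typ>\<open>ennreal\<close> is 0, which is the length of a one-point curve.\<close>

definition is_partition :: "real \<Rightarrow> real \<Rightarrow> nat \<Rightarrow> (nat \<Rightarrow> real) \<Rightarrow> bool" where
  "is_partition a b n t \<longleftrightarrow> t 0 = a \<and> t (Suc n) = b \<and> (\<forall>i\<le>n. t i < t (Suc i))"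

definition curve_length :: "(real \<Rightarrow> 'a::metric_space) \<Rightarrow> real \<Rightarrow> real \<Rightarrow> ennreal" where
  "curve_length C a b =
     Sup {ennreal (\<Sum>i\<le>n. dist (C (t i)) (C (t (Suc i)))) | n t. is_partition a b n t}"

definition curve_from_to :: "'a::metric_space set \<Rightarrow> 'a \<Rightarrow> 'a \<Rightarrow> real \<Rightarrow> real \<Rightarrow> (real \<Rightarrow> 'a) \<Rightarrow> bool" where
  "curve_from_to S p q a b C \<longleftrightarrow>
     a \<le> b \<and> continuous_on {a..b} C \<and> C a = p \<and> C b = q \<and> C ` {a..b} \<subseteq> S"

definition geodesic_from_to :: "'a::metric_space set \<Rightarrow> 'a \<Rightarrow> 'a \<Rightarrow> real \<Rightarrow> real \<Rightarrow> (real \<Rightarrow> 'a) \<Rightarrow> bool" where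
  "geodesic_from_to S p q a b G \<longleftrightarrow>
     curve_from_to S p q a b G \<and>
     (\<forall>a' b' D. curve_from_to S p q a' b' D \<longrightarrow> curve_length G a b \<le> curve_length D a' b')"

text \<open>Here \<open>c\<close> and \<open>r\<close> are the center and radius of the sphere. The great circle in question is cut
  out by the affine plane through \<open>c\<close> with directions \<open>p - c\<close> and \<open>u\<close>. The parametrization may
  pause, since \<open>\<theta>\<close> need only be weakly increasing.\<close>

definition minor_arc_from_to ::
    "'a::real_inner \<Rightarrow> real \<Rightarrow> 'a \<Rightarrow> 'a \<Rightarrow> real \<Rightarrow> real \<Rightarrow> (real \<Rightarrow> 'a) \<Rightarrow> bool" where
  "minor_arc_from_to c r p q a b C \<longleftrightarrow>
     (\<exists>u \<omega> \<theta>. norm u = 1 \<and> orthogonal u (p - c) \<and> \<omega> \<in> {0..pi} \<and>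
        continuous_on {a..b} \<theta> \<and> mono_on {a..b} \<theta> \<and> \<theta> ` {a..b} = {0..\<omega>} \<and>
        (\<forall>t\<in>{a..b}. C t = c + cos (\<theta> t) *\<^sub>R (p - c) + (r * sin (\<theta> t)) *\<^sub>R u) \<and>
        C b = q)"

end

theory Submission
  imports Defs
begin

text \<open>The central angle \<open>\<angle>(x, y)\<close> of two points of the sphere is a metric, and every curve on the
  sphere has length at least \<open>r\<close> times the angle between its endpoints
  (\<open>central_angle_le_curve_length\<close>), while minor arcs attain this bound. So a geodesic
  \<open>C\<close> from \<open>p\<close> to \<open>q\<close> has length at most \<open>r \<angle>(p, q)\<close>. Since length is superadditive, cutting \<open>C\<close> at
  \<open>s < t\<close> leaves no room for a strict triangle inequality:
  \<open>\<angle>(p, C s) + \<angle>(C s, C t) = \<angle>(p, C t)\<close>.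
  Hence \<open>\<theta> t = \<angle>(p, C t)\<close> is nondecreasing, and the equality case of the triangle inequality
  (\<open>arccos_triangle_equality\<close>) places all of \<open>C\<close> on one great circle, on which \<open>\<theta>\<close> is the angular
  parameter. So a geodesic that is not constant is a minor arc.

  The great circle is determined by \<open>p\<close> and the point of \<open>C\<close> at which \<open>\<theta>\<close> is half its final value.
  The endpoint \<open>q\<close> would not do, because it may be antipodal to \<open>p\<close>; the half-way point is neither
  \<open>p\<close> nor its antipode as long as \<open>p \<noteq> q\<close>. If \<open>p = q\<close>, the constant curve has length zero and is
  shorter than \<open>C\<close>.\<close>

section \<open>Angles between unit vectors\<close>

lemma inner_unit_bounds:
  fixes x y :: "'a::real_inner"
  assumes "norm x = 1" "norm y = 1"
  shows "-1 \<le> x \<bullet> y" "x \<bullet> y \<le> 1"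
  using Cauchy_Schwarz_ineq2[of x y] assms by auto

lemma cos_arccos_inner:
  fixes x y :: "'a::real_inner"
  assumes "norm x = 1" "norm y = 1"
  shows "cos (arccos (x \<bullet> y)) = x \<bullet> y"
  using inner_unit_bounds[OF assms] by simp

lemma arccos_inner_bounds:
  fixes x y :: "'a::real_inner"
  assumes "norm x = 1" "norm y = 1"
  shows "0 \<le> arccos (x \<bullet> y)" "arccos (x \<bullet> y) \<le> pi"
  using inner_unit_bounds[OF assms] by (auto intro: arccos_lbound arccos_ubound)

lemma norm_unit_diff:
  fixes x y :: "'a::real_inner"
  assumes "norm x = 1" "norm y = 1"
  shows "(norm (x - y))\<^sup>2 = 2 - 2 * (x \<bullet> y)"
  using assms by (simp add: power2_norm_eq_inner inner_diff inner_commute norm_eq_1)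

lemma norm_tangential_component:
  fixes x y :: "'a::real_inner"
  assumes x: "norm x = 1" and y: "norm y = 1"
  shows "norm (x - (x \<bullet> y) *\<^sub>R y) = sin (arccos (x \<bullet> y))"
proof -
  have "(norm (x - (x \<bullet> y) *\<^sub>R y))\<^sup>2 = 1 - (x \<bullet> y)\<^sup>2"
    using x y unfolding power2_norm_eq_inner
    by (simp add: inner_diff inner_commute norm_eq_1 power2_eq_square)
  also have "\<dots> = (sin (arccos (x \<bullet> y)))\<^sup>2"
    using cos_arccos_inner[OF x y] by (simp add: sin_squared_eq)
  finally show ?thesis
    by (rule power2_eq_imp_eq) (auto intro: sin_ge_zero arccos_inner_bounds[OF x y])
qed

text \<open>Only \<open>\<alpha> + \<beta> \<le> \<pi>\<close> needs an argument. The components of \<open>x\<close> and \<open>z\<close> orthogonal to \<open>y\<close> have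
  norms \<open>sin \<alpha>\<close> and \<open>sin \<beta>\<close>, so Cauchy-Schwarz bounds \<open>x \<bullet> z\<close> from below by \<open>cos (\<alpha> + \<beta>)\<close>.\<close>
lemma arccos_triangle:
  fixes x y z :: "'a::real_inner"
  assumes x: "norm x = 1" and y: "norm y = 1" and z: "norm z = 1"
  shows "arccos (x \<bullet> z) \<le> arccos (x \<bullet> y) + arccos (y \<bullet> z)"
proof -
  define \<alpha> \<beta> where "\<alpha> = arccos (x \<bullet> y)" and "\<beta> = arccos (y \<bullet> z)"
  note bounds = arccos_inner_bounds[OF x y, folded \<alpha>_def] arccos_inner_bounds[OF y z, folded \<beta>_def]
    arccos_inner_bounds[OF x z]
  note cosines = cos_arccos_inner[OF x y, folded \<alpha>_def] cos_arccos_inner[OF y z, folded \<beta>_def]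
    cos_arccos_inner[OF x z]
  show ?thesis
  proof (cases "\<alpha> + \<beta> \<le> pi")
    case True
    have "\<bar>(x - (x \<bullet> y) *\<^sub>R y) \<bullet> (z - (z \<bullet> y) *\<^sub>R y)\<bar> \<le> sin \<alpha> * sin \<beta>"
      using Cauchy_Schwarz_ineq2[of "x - (x \<bullet> y) *\<^sub>R y" "z - (z \<bullet> y) *\<^sub>R y"]
        norm_tangential_component[OF x y] norm_tangential_component[OF z y]
      by (simp add: \<alpha>_def \<beta>_def inner_commute)
    moreover have "(x - (x \<bullet> y) *\<^sub>R y) \<bullet> (z - (z \<bullet> y) *\<^sub>R y) = x \<bullet> z - cos \<alpha> * cos \<beta>"
      using y cosines by (simp add: inner_diff inner_commute norm_eq_1)
    ultimately have "cos (\<alpha> + \<beta>) \<le> cos (arccos (x \<bullet> z))"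
      using cosines by (simp add: cos_add)
    then show ?thesis
      using True bounds by (subst (asm) cos_mono_le_eq) (auto simp: \<alpha>_def \<beta>_def)
  qed (use bounds in \<open>simp add: \<alpha>_def \<beta>_def\<close>)
qed

text \<open>This is spherical interpolation: \<open>y\<close> is the point at angle \<open>\<alpha>\<close> on the arc from \<open>x\<close> to \<open>z\<close>. Without a
  division by \<open>sin (\<alpha> + \<beta>)\<close> the identity holds for antipodal \<open>x\<close> and \<open>z\<close> as well. The square of the
  distance between the two sides expands to zero by the addition formulas.\<close>
lemma arccos_triangle_equality:
  fixes x y z :: "'a::real_inner"
  assumes x: "norm x = 1" and y: "norm y = 1" and z: "norm z = 1"
    and \<alpha>: "arccos (x \<bullet> y) = \<alpha>" and \<beta>: "arccos (y \<bullet> z) = \<beta>"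
    and eq: "arccos (x \<bullet> z) = \<alpha> + \<beta>"
  shows "sin \<beta> *\<^sub>R x + sin \<alpha> *\<^sub>R z = sin (\<alpha> + \<beta>) *\<^sub>R y"
proof -
  have xy: "x \<bullet> y = cos \<alpha>" and yz: "y \<bullet> z = cos \<beta>" and xz: "x \<bullet> z = cos (\<alpha> + \<beta>)"
    using cos_arccos_inner x y z \<alpha> \<beta> eq by metis+
  define w where "w = sin \<beta> *\<^sub>R x + sin \<alpha> *\<^sub>R z - sin (\<alpha> + \<beta>) *\<^sub>R y"
  have units: "x \<bullet> x = 1" "y \<bullet> y = 1" "z \<bullet> z = 1"
    using x y z by (simp_all add: norm_eq_1)
  have "w \<bullet> w = (sin \<beta>)\<^sup>2 + (sin \<alpha>)\<^sup>2 + (sin (\<alpha> + \<beta>))\<^sup>2 + 2 * sin \<alpha> * sin \<beta> * cos (\<alpha> + \<beta>)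
      - 2 * sin (\<alpha> + \<beta>) * (sin \<beta> * cos \<alpha> + sin \<alpha> * cos \<beta>)"
    using xy yz xz units
    by (simp add: w_def inner_add inner_diff inner_commute power2_eq_square algebra_simps)
  also have "\<dots> = (sin \<beta>)\<^sup>2 * (1 - (sin \<alpha>)\<^sup>2 - (cos \<alpha>)\<^sup>2) + (sin \<alpha>)\<^sup>2 * (1 - (sin \<beta>)\<^sup>2 - (cos \<beta>)\<^sup>2)"
  proof -
    have "sb\<^sup>2 + sa\<^sup>2 + (sa * cb + ca * sb)\<^sup>2 + 2 * sa * sb * (ca * cb - sa * sb)
        - 2 * (sa * cb + ca * sb) * (sb * ca + sa * cb)
      = sb\<^sup>2 * (1 - sa\<^sup>2 - ca\<^sup>2) + sa\<^sup>2 * (1 - sb\<^sup>2 - cb\<^sup>2)" for sa ca sb cb :: real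
      by (simp add: power2_eq_square algebra_simps)
    then show ?thesis
      unfolding sin_add cos_add .
  qed
  also have "\<dots> = 0"
    by (simp add: sin_squared_eq)
  finally show ?thesis
    by (simp add: w_def)
qed

text \<open>This is polar coordinates in the plane of \<open>x\<close> and \<open>y\<close>; the hypotheses say that the two vectors
  span a plane.\<close>
lemma unit_vector_polar:
  fixes x y :: "'a::real_inner"
  assumes x: "norm x = 1" and y: "norm y = 1"
    and pos: "0 < arccos (x \<bullet> y)" and less: "arccos (x \<bullet> y) < pi"
  obtains u where "norm u = 1" "u \<bullet> x = 0"
    "y = cos (arccos (x \<bullet> y)) *\<^sub>R x + sin (arccos (x \<bullet> y)) *\<^sub>R u"
proof
  define s where "s = sin (arccos (x \<bullet> y))"
  define u where "u = (y - (y \<bullet> x) *\<^sub>R x) /\<^sub>R s"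
  have s: "s > 0"
    unfolding s_def using pos less by (rule sin_gt_zero)
  show "norm u = 1"
    using s norm_tangential_component[OF y x] by (simp add: u_def s_def inner_commute)
  show "u \<bullet> x = 0"
    using x by (simp add: u_def inner_diff norm_eq_1)
  show "y = cos (arccos (x \<bullet> y)) *\<^sub>R x + sin (arccos (x \<bullet> y)) *\<^sub>R u"
    using s cos_arccos_inner[OF x y] by (simp add: u_def inner_commute flip: s_def)
qed

lemma mult_cos_le_sin:
  fixes x :: real
  assumes "0 \<le> x" "x \<le> pi"
  shows "x * cos x \<le> sin x"
proof -
  have "(\<lambda>x. sin x - x * cos x) 0 \<le> (\<lambda>x. sin x - x * cos x) x"
  proof (rule DERIV_nonneg_imp_nondecreasing[OF assms(1)])
    fix t assume t: "0 \<le> t" "t \<le> x"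
    have "((\<lambda>x. sin x - x * cos x) has_real_derivative t * sin t) (at t)"
      by (auto intro!: derivative_eq_intros)
    moreover have "0 \<le> t * sin t"
      using t assms by (intro mult_nonneg_nonneg sin_ge_zero) auto
    ultimately show "\<exists>y. ((\<lambda>x. sin x - x * cos x) has_real_derivative y) (at t) \<and> 0 \<le> y"
      by blast
  qed
  then show ?thesis by simp
qed

text \<open>For nearby points the angle \<open>\<alpha>\<close> is almost bounded by the chord \<open>2 sin (\<alpha> / 2)\<close>: the chord is at
  least \<open>\<alpha> cos (\<alpha> / 2)\<close>, and \<open>cos (\<alpha> / 2) \<ge> cos \<alpha> = x \<bullet> y\<close>.\<close>
lemma angle_le_chord:
  fixes x y :: "'a::real_inner"
  assumes x: "norm x = 1" and y: "norm y = 1" and k: "k \<le> x \<bullet> y"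
  shows "k * arccos (x \<bullet> y) \<le> norm (x - y)"
proof -
  define \<alpha> where "\<alpha> = arccos (x \<bullet> y)"
  have \<alpha>: "0 \<le> \<alpha>" "\<alpha> \<le> pi" and cos: "cos \<alpha> = x \<bullet> y"
    using arccos_inner_bounds[OF x y] cos_arccos_inner[OF x y] by (simp_all add: \<alpha>_def)
  have half: "0 \<le> sin (\<alpha> / 2)"
    using \<alpha> by (intro sin_ge_zero) auto
  have "(norm (x - y))\<^sup>2 = (2 * sin (\<alpha> / 2))\<^sup>2"
    using norm_unit_diff[OF x y] cos_double_sin[of "\<alpha> / 2"] cos
    by (simp add: power_mult_distrib)
  then have chord: "norm (x - y) = 2 * sin (\<alpha> / 2)"
    by (rule power2_eq_imp_eq) (use half in auto)
  have "k \<le> cos (\<alpha> / 2)"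
    using k cos \<alpha> cos_monotone_0_pi_le[of "\<alpha> / 2" \<alpha>] by simp
  then have "k * \<alpha> \<le> cos (\<alpha> / 2) * \<alpha>"
    using \<alpha> by (rule_tac mult_right_mono)
  also have "\<dots> \<le> 2 * sin (\<alpha> / 2)"
    using mult_cos_le_sin[of "\<alpha> / 2"] \<alpha> by (simp add: field_simps)
  finally show ?thesis
    by (simp add: chord \<alpha>_def)
qed

section \<open>Length of curves\<close>

lemma partition_sum_le_curve_length:
  assumes "is_partition a b n t"
  shows "ennreal (\<Sum>i\<le>n. dist (C (t i)) (C (t (Suc i)))) \<le> curve_length C a b"
  unfolding curve_length_def using assms by (intro Sup_upper) blast

lemma curve_length_leI:
  assumes "\<And>n t. is_partition a b n t \<Longrightarrow>
    ennreal (\<Sum>i\<le>n. dist (C (t i)) (C (t (Suc i)))) \<le> L"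
  shows "curve_length C a b \<le> L"
  unfolding curve_length_def using assms by (intro Sup_least) blast

lemma is_partition_trivial: "a < b \<Longrightarrow> is_partition a b 0 (\<lambda>i. if i = 0 then a else b)"
  by (simp add: is_partition_def)

lemma is_partition_points:
  assumes P: "is_partition a b n t" and "i \<le> Suc n"
  shows "t i \<in> {a..b}"
proof -
  have mono: "t j \<le> t k" if "j \<le> k" "k \<le> Suc n" for j k
    using that
  proof (induction k rule: dec_induct)
    case (step k)
    then have "t k < t (Suc k)"
      using P by (auto simp: is_partition_def)
    with step show ?case by simp
  qed simp
  show ?thesis
    using mono[of 0 i] mono[of i "Suc n"] assms by (auto simp: is_partition_def)
qed

lemma is_partition_imp_less:
  assumes "is_partition a b n t"
  shows "a < b"
  using is_partition_points[OF assms, of 1] assms by (force simp: is_partition_def)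

lemma curve_length_refl: "curve_length C a a = 0"
proof -
  have "curve_length C a a \<le> 0"
    by (rule curve_length_leI) (auto dest: is_partition_imp_less)
  then show ?thesis by simp
qed

lemma dist_le_curve_length:
  assumes "a \<le> b"
  shows "ennreal (dist (C a) (C b)) \<le> curve_length C a b"
proof (cases "a = b")
  case False
  then show ?thesis
    using partition_sum_le_curve_length[OF is_partition_trivial[of a b], of C] assms by simp
qed simp

lemma is_partition_append:
  assumes P: "is_partition a m n t" and Q: "is_partition m b k s"
  shows "is_partition a b (Suc n + k) (\<lambda>i. if i \<le> Suc n then t i else s (i - Suc n))"
  unfolding is_partition_def
proof (intro conjI allI impI)
  fix i assume i: "i \<le> Suc n + k"
  consider "i \<le> n" | "i = Suc n" | "Suc n < i" by linarith
  then show "(if i \<le> Suc n then t i else s (i - Suc n))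
      < (if Suc i \<le> Suc n then t (Suc i) else s (Suc i - Suc n))"
  proof cases
    case 3
    then have "s (i - Suc n) < s (Suc (i - Suc n))"
      using Q i by (simp add: is_partition_def)
    with 3 show ?thesis by (simp add: Suc_diff_Suc)
  qed (use P Q in \<open>auto simp: is_partition_def\<close>)
qed (use P Q in \<open>auto simp: is_partition_def\<close>)

lemma partition_sum_append:
  fixes C :: "real \<Rightarrow> 'a::metric_space"
  assumes P: "is_partition a m n t" and Q: "is_partition m b k s"
  defines "w \<equiv> \<lambda>i. if i \<le> Suc n then t i else s (i - Suc n)"
  shows "(\<Sum>i\<le>Suc n + k. dist (C (w i)) (C (w (Suc i)))) =
    (\<Sum>i\<le>n. dist (C (t i)) (C (t (Suc i)))) + (\<Sum>i\<le>k. dist (C (s i)) (C (s (Suc i))))"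
proof -
  let ?f = "\<lambda>i. dist (C (w i)) (C (w (Suc i)))"
  have w: "w (i + Suc n) = s i" for i
    using P Q by (auto simp: w_def is_partition_def)
  have split: "{..<Suc (Suc n + k)} = {..<Suc n} \<union> {0 + Suc n..<Suc k + Suc n}"
    by auto
  have "sum ?f {..<Suc (Suc n + k)} = sum ?f {..<Suc n} + sum ?f {0 + Suc n..<Suc k + Suc n}"
    unfolding split by (intro sum.union_disjoint) auto
  also have "sum ?f {0 + Suc n..<Suc k + Suc n} = (\<Sum>i=0..<Suc k. ?f (i + Suc n))"
    by (rule sum.shift_bounds_nat_ivl)
  also have "\<dots> = (\<Sum>i<Suc k. dist (C (s i)) (C (s (Suc i))))"
    using w w[of "Suc _"] by (simp add: atLeast0LessThan)
  also have "sum ?f {..<Suc n} = (\<Sum>i<Suc n. dist (C (t i)) (C (t (Suc i))))"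
    by (intro sum.cong) (auto simp: w_def)
  finally show ?thesis
    by (simp only: lessThan_Suc_atMost)
qed

lemma curve_length_superadditive:
  assumes "a \<le> m" "m \<le> b"
  shows "curve_length C a m + curve_length C m b \<le> curve_length C a b"
proof (cases "a = m \<or> m = b")
  case False
  define len where "len = (\<lambda>(n, t). ennreal (\<Sum>i\<le>n::nat. dist (C (t i)) (C (t (Suc i)))))"
  define \<P> where "\<P> x y = {(n, t). is_partition x y n t}" for x y
  have length: "curve_length C x y = (SUP \<pi>\<in>\<P> x y. len \<pi>)" for x y
    unfolding curve_length_def len_def \<P>_def by (rule arg_cong[where f = Sup]) auto
  have nonempty: "\<P> a m \<noteq> {}" "\<P> m b \<noteq> {}"
    using False assms is_partition_trivial unfolding \<P>_def by (blast intro: le_neq_trans)+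
  have sum_le: "len \<pi> + len \<rho> \<le> curve_length C a b" if "\<pi> \<in> \<P> a m" "\<rho> \<in> \<P> m b" for \<pi> \<rho>
  proof -
    obtain n t k s where \<pi>: "\<pi> = (n, t)" and \<rho>: "\<rho> = (k, s)"
      by (cases \<pi>, cases \<rho>)
    have P: "is_partition a m n t" and Q: "is_partition m b k s"
      using that by (auto simp: \<P>_def \<pi> \<rho>)
    show ?thesis
      using partition_sum_le_curve_length[OF is_partition_append[OF P Q], of C]
      unfolding partition_sum_append[OF P Q]
      by (simp add: \<pi> \<rho> len_def sum_nonneg)
  qed
  have "len \<pi> + curve_length C m b \<le> curve_length C a b" if "\<pi> \<in> \<P> a m" for \<pi>
  proof -
    have "len \<pi> + curve_length C m b = (SUP \<rho>\<in>\<P> m b. len \<pi> + len \<rho>)"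
      unfolding length[of m b] by (rule ennreal_SUP_add_right[OF nonempty(2)])
    also have "\<dots> \<le> curve_length C a b"
      by (rule SUP_least) (rule sum_le[OF that])
    finally show ?thesis .
  qed
  then have "(SUP \<pi>\<in>\<P> a m. len \<pi> + curve_length C m b) \<le> curve_length C a b"
    by (rule SUP_least)
  then show ?thesis
    unfolding length[of a m] ennreal_SUP_add_left[OF nonempty(1)] .
qed (auto simp: curve_length_refl)

lemma curve_length_lipschitz:
  fixes C :: "real \<Rightarrow> 'a::metric_space"
  assumes "\<And>x y. dist (C x) (C y) \<le> K * \<bar>x - y\<bar>"
  shows "curve_length C a b \<le> ennreal (K * (b - a))"
proof (rule curve_length_leI)
  fix n t assume P: "is_partition a b n t"
  have "(\<Sum>i\<le>n. dist (C (t i)) (C (t (Suc i)))) \<le> (\<Sum>i\<le>n. K * (t (Suc i) - t i))"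
  proof (rule sum_mono)
    fix i assume "i \<in> {..n}"
    then have "t i < t (Suc i)"
      using P by (simp add: is_partition_def)
    then show "dist (C (t i)) (C (t (Suc i))) \<le> K * (t (Suc i) - t i)"
      using assms[of "t i" "t (Suc i)"] by simp
  qed
  also have "\<dots> = K * (b - a)"
    using P sum_lessThan_telescope[of t "Suc n"]
    by (simp add: is_partition_def lessThan_Suc_atMost flip: sum_distrib_left)
  finally show "ennreal (\<Sum>i\<le>n. dist (C (t i)) (C (t (Suc i)))) \<le> ennreal (K * (b - a))"
    by (rule ennreal_leI)
qed

section \<open>Central angles on a sphere\<close>

definition direction :: "'a::real_inner \<Rightarrow> real \<Rightarrow> 'a \<Rightarrow> 'a" where
  "direction c r x = (x - c) /\<^sub>R r"

definition central_angle :: "'a::real_inner \<Rightarrow> real \<Rightarrow> 'a \<Rightarrow> 'a \<Rightarrow> real" where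
  "central_angle c r x y = arccos (direction c r x \<bullet> direction c r y)"

lemma norm_direction: "r > 0 \<Longrightarrow> x \<in> sphere c r \<Longrightarrow> norm (direction c r x) = 1"
  by (simp add: direction_def dist_norm norm_minus_commute)

lemma eq_center_plus_direction: "r > 0 \<Longrightarrow> x = c + r *\<^sub>R direction c r x"
  by (simp add: direction_def)

lemma dist_eq_norm_direction: "r > 0 \<Longrightarrow> dist x y = r * norm (direction c r x - direction c r y)"
  by (simp add: direction_def dist_norm flip: scaleR_diff_right)

lemma central_angle_refl: "r > 0 \<Longrightarrow> x \<in> sphere c r \<Longrightarrow> central_angle c r x x = 0"
  using norm_direction[of r x c] by (simp add: central_angle_def norm_eq_1)

text \<open>It suffices to bound \<open>k r\<close> times the angle for each \<open>k < 1\<close>. This weaker bound is additive in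
  the curve, by the triangle inequality for angles and the superadditivity of length, and holds for
  short pieces since there the angle is almost the chord over \<open>r\<close>. A bisection of the parameter
  interval extends it to the whole curve.\<close>
lemma central_angle_le_curve_length:
  fixes C :: "real \<Rightarrow> 'a::real_inner"
  assumes r: "r > 0" and ab: "a \<le> b" and cont: "continuous_on {a..b} C"
    and img: "C ` {a..b} \<subseteq> sphere c r"
  shows "ennreal (r * central_angle c r (C a) (C b)) \<le> curve_length C a b"
proof -
  define D where "D t = direction c r (C t)" for t
  have unit: "norm (D t) = 1" if "t \<in> {a..b}" for t
    unfolding D_def using norm_direction[OF r] img that by blast
  define A where "A s t = r * arccos (D s \<bullet> D t)" for s t
  have A_nonneg: "A s t \<ge> 0" if "s \<in> {a..b}" "t \<in> {a..b}" for s t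
    unfolding A_def using arccos_inner_bounds(1)[OF unit unit, OF that] r by simp
  have weak: "ennreal (k * A a b) \<le> curve_length C a b" if k: "0 < k" "k < 1" for k
  proof -
    define P where "P s t \<longleftrightarrow> (a \<le> s \<longrightarrow> s \<le> t \<longrightarrow> t \<le> b \<longrightarrow>
      ennreal (k * A s t) \<le> curve_length C s t)" for s t
    have "P a b"
      using ab
    proof (induction rule: Bolzano)
      case (trans s m t)
      show ?case
        unfolding P_def
      proof (intro impI)
        assume "a \<le> s" "t \<le> b"
        with trans have pts: "s \<in> {a..b}" "m \<in> {a..b}" "t \<in> {a..b}" by auto
        have "A s t \<le> A s m + A m t"
          using arccos_triangle[OF unit unit unit, OF pts] r
          by (simp add: A_def flip: distrib_left)
        then have "k * A s t \<le> k * A s m + k * A m t"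
          using k by (simp flip: distrib_left)
        then have "ennreal (k * A s t) \<le> ennreal (k * A s m) + ennreal (k * A m t)"
          using A_nonneg pts k by (simp add: ennreal_leI flip: ennreal_plus)
        also have "\<dots> \<le> curve_length C s m + curve_length C m t"
          using trans pts by (intro add_mono) (auto simp: P_def)
        also have "\<dots> \<le> curve_length C s t"
          using trans by (intro curve_length_superadditive)
        finally show "ennreal (k * A s t) \<le> curve_length C s t" .
      qed
    next
      case (local x)
      \<comment> \<open>A chord of length at most \<open>2 e\<close> has a central angle whose cosine is at least \<open>k\<close>.\<close>
      define e where "e = r * sqrt (2 * (1 - k)) / 2"
      have "e > 0"
        using r k by (simp add: e_def)
      then obtain d where d: "d > 0" "\<And>t. t \<in> {a..b} \<Longrightarrow> dist t x < d \<Longrightarrow> dist (C t) (C x) < e"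
        using cont local unfolding continuous_on_iff by (meson atLeastAtMost_iff)
      have "P s t" if "s \<le> x" "x \<le> t" "t - s < d" for s t
        unfolding P_def
      proof (intro impI)
        assume "a \<le> s" "s \<le> t" "t \<le> b"
        then have pts: "s \<in> {a..b}" "t \<in> {a..b}" by auto
        have "dist (C s) (C t) \<le> dist (C s) (C x) + dist (C t) (C x)"
          by (rule dist_triangle2)
        also have "\<dots> \<le> e + e"
          using d(2)[OF pts(1)] d(2)[OF pts(2)] that by (simp add: dist_real_def)
        also have "\<dots> = r * sqrt (2 * (1 - k))"
          by (simp add: e_def)
        finally have "norm (D s - D t) \<le> sqrt (2 * (1 - k))"
          using r dist_eq_norm_direction[OF r, of "C s" "C t" c] by (simp add: D_def)
        then have "(norm (D s - D t))\<^sup>2 \<le> 2 * (1 - k)"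
          using k power_mono[of "norm (D s - D t)" "sqrt (2 * (1 - k))" 2] by simp
        then have "k \<le> D s \<bullet> D t"
          using norm_unit_diff[OF unit unit, OF pts] by simp
        then have "k * arccos (D s \<bullet> D t) \<le> norm (D s - D t)"
          by (rule angle_le_chord[OF unit unit, OF pts])
        then have "k * A s t \<le> dist (C s) (C t)"
          using r dist_eq_norm_direction[OF r, of "C s" "C t" c]
          by (simp add: A_def D_def mult.left_commute)
        then have "ennreal (k * A s t) \<le> ennreal (dist (C s) (C t))"
          by (rule ennreal_leI)
        also have "\<dots> \<le> curve_length C s t"
          using \<open>s \<le> t\<close> by (rule dist_le_curve_length)
        finally show "ennreal (k * A s t) \<le> curve_length C s t" .
      qed
      with d(1) show ?case by blast
    qed
    then show ?thesis
      using ab by (simp add: P_def)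
  qed
  have "ennreal (A a b) \<le> curve_length C a b"
  proof (cases "curve_length C a b")
    case (real l)
    have "k * A a b \<le> l" if "0 < k" "k < 1" for k
      using weak[OF that] real A_nonneg[of a b] ab that by simp
    then have "A a b \<le> l"
      by (rule field_le_mult_one_interval)
    then show ?thesis
      using real by (simp add: ennreal_leI)
  qed simp
  then show ?thesis
    by (simp add: A_def D_def central_angle_def)
qed

section \<open>Arcs of great circles and geodesics\<close>

definition great_circle_arc :: "'a::real_inner \<Rightarrow> real \<Rightarrow> 'a \<Rightarrow> 'a \<Rightarrow> real \<Rightarrow> 'a" where
  "great_circle_arc c r x u t = c + r *\<^sub>R (cos t *\<^sub>R x + sin t *\<^sub>R u)"

lemma norm_combination_orthonormal:
  fixes x u :: "'a::real_inner"
  assumes "norm x = 1" "norm u = 1" "u \<bullet> x = 0"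
  shows "(norm (\<alpha> *\<^sub>R x + \<beta> *\<^sub>R u))\<^sup>2 = \<alpha>\<^sup>2 + \<beta>\<^sup>2"
  using assms unfolding power2_norm_eq_inner
  by (simp add: inner_add inner_commute norm_eq_1 power2_eq_square)

lemma great_circle_arc_in_sphere:
  assumes "r > 0" "norm x = 1" "norm u = 1" "u \<bullet> x = 0"
  shows "great_circle_arc c r x u t \<in> sphere c r"
proof -
  let ?v = "cos t *\<^sub>R x + sin t *\<^sub>R u"
  have "(norm ?v)\<^sup>2 = 1"
    using norm_combination_orthonormal[OF assms(2-4)] by simp
  then have "norm ?v = 1"
    using power2_eq_imp_eq[of "norm ?v" 1] by simp
  then show ?thesis
    using assms(1) by (simp add: great_circle_arc_def dist_norm)
qed

lemma great_circle_arc_lipschitz: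
  assumes "r > 0" "norm x = 1" "norm u = 1" "u \<bullet> x = 0"
  shows "dist (great_circle_arc c r x u s) (great_circle_arc c r x u t) \<le> r * \<bar>s - t\<bar>"
proof -
  let ?v = "(cos s - cos t) *\<^sub>R x + (sin s - sin t) *\<^sub>R u"
  have "(norm ?v)\<^sup>2 = (cos s - cos t)\<^sup>2 + (sin s - sin t)\<^sup>2"
    by (rule norm_combination_orthonormal[OF assms(2-4)])
  also have "\<dots> = ((sin s)\<^sup>2 + (cos s)\<^sup>2) + ((sin t)\<^sup>2 + (cos t)\<^sup>2) - 2 * cos (s - t)"
    by (simp add: cos_diff power2_eq_square algebra_simps)
  also have "\<dots> = (2 * \<bar>sin ((s - t) / 2)\<bar>)\<^sup>2"
    using cos_double_sin[of "(s - t) / 2"] by (simp add: power_mult_distrib diff_divide_distrib)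
  also have "\<dots> \<le> \<bar>s - t\<bar>\<^sup>2"
    using abs_sin_x_le_abs_x[of "(s - t) / 2"] by (intro power_mono) auto
  finally have "norm ?v \<le> \<bar>s - t\<bar>"
    by (rule power2_le_imp_le) simp
  moreover have "great_circle_arc c r x u s - great_circle_arc c r x u t = r *\<^sub>R ?v"
    by (simp add: great_circle_arc_def algebra_simps)
  ultimately show ?thesis
    using assms(1) by (simp add: dist_norm)
qed

lemma geodesic_length_le_great_circle_arc:
  assumes geo: "geodesic_from_to (sphere c r) p q a b C" and r: "r > 0"
    and u: "norm x = 1" "norm u = 1" "u \<bullet> x = 0"
    and p: "p = c + r *\<^sub>R x" and q: "q = great_circle_arc c r x u \<omega>" and \<omega>: "0 \<le> \<omega>"
  shows "curve_length C a b \<le> ennreal (r * \<omega>)"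
proof -
  have "curve_from_to (sphere c r) p q 0 \<omega> (great_circle_arc c r x u)"
    unfolding curve_from_to_def
  proof (intro conjI)
    show "continuous_on {0..\<omega>} (great_circle_arc c r x u)"
      unfolding great_circle_arc_def by (intro continuous_intros)
    show "great_circle_arc c r x u ` {0..\<omega>} \<subseteq> sphere c r"
      using great_circle_arc_in_sphere[OF r u] by blast
  qed (use \<omega> p q in \<open>simp_all add: great_circle_arc_def\<close>)
  then have "curve_length C a b \<le> curve_length (great_circle_arc c r x u) 0 \<omega>"
    using geo by (simp add: geodesic_from_to_def)
  also have "\<dots> \<le> ennreal (r * (\<omega> - 0))"
    by (rule curve_length_lipschitz, rule great_circle_arc_lipschitz[OF r u])
  finally show ?thesis by simp
qed

lemma geodesic_loop_length:
  assumes geo: "geodesic_from_to S p p a b C"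
  shows "curve_length C a b = 0"
proof -
  have "curve_from_to S p p a a (\<lambda>_. p)"
    using geo by (force simp: geodesic_from_to_def curve_from_to_def)
  then have "curve_length C a b \<le> curve_length (\<lambda>_. p) a a"
    using geo unfolding geodesic_from_to_def by blast
  then show ?thesis
    by (simp add: curve_length_refl)
qed

lemma continuous_on_central_angle:
  assumes r: "r > 0" and p: "p \<in> sphere c r" and cont: "continuous_on S C"
    and img: "C ` S \<subseteq> sphere c r"
  shows "continuous_on S (\<lambda>t. central_angle c r p (C t))"
  unfolding central_angle_def
proof (rule continuous_on_arccos)
  show "continuous_on S (\<lambda>t. direction c r p \<bullet> direction c r (C t))"
    unfolding direction_def using cont by (intro continuous_intros)
  show "\<forall>t\<in>S. - 1 \<le> direction c r p \<bullet> direction c r (C t) \<and>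
      direction c r p \<bullet> direction c r (C t) \<le> 1"
    using inner_unit_bounds[OF norm_direction[OF r p] norm_direction[OF r]] img by blast
qed

text \<open>The great circle arc to compare with is the one through \<open>q\<close>, unless \<open>q\<close> is antipodal to \<open>p\<close>.
  In that case any half great circle will do, and the curve itself supplies the second direction:
  it passes through a point at a right angle to \<open>p\<close>. On a line, where the sphere contains no half
  great circle, no curve joins antipodal points.\<close>
lemma geodesic_length_le_central_angle:
  fixes C :: "real \<Rightarrow> 'a::real_inner"
  assumes geo: "geodesic_from_to (sphere c r) p q a b C" and r: "r > 0" and "p \<noteq> q"
  shows "curve_length C a b \<le> ennreal (r * central_angle c r p q)"
proof -
  have ab: "a \<le> b" and cont: "continuous_on {a..b} C" and ends: "C a = p" "C b = q"
    and img: "C ` {a..b} \<subseteq> sphere c r"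
    using geo by (auto simp: geodesic_from_to_def curve_from_to_def)
  have pq: "p \<in> sphere c r" "q \<in> sphere c r"
    using image_subset_iff[THEN iffD1, OF img] ab ends by force+
  define x y where "x = direction c r p" and "y = direction c r q"
  have x: "norm x = 1" and y: "norm y = 1"
    unfolding x_def y_def using norm_direction[OF r] pq by blast+
  have px: "p = c + r *\<^sub>R x" and qy: "q = c + r *\<^sub>R y"
    unfolding x_def y_def by (rule eq_center_plus_direction[OF r])+
  define \<omega> where "\<omega> = central_angle c r p q"
  have \<omega>_eq: "arccos (x \<bullet> y) = \<omega>"
    by (simp add: \<omega>_def central_angle_def x_def y_def)
  have \<omega>: "0 \<le> \<omega>" "\<omega> \<le> pi"
    using arccos_inner_bounds[OF x y] \<omega>_eq by simp_all
  have cos_\<omega>: "x \<bullet> y = cos \<omega>"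
    using cos_arccos_inner[OF x y] \<omega>_eq by simp
  have "\<omega> \<noteq> 0"
  proof
    assume "\<omega> = 0"
    then have "(norm (x - y))\<^sup>2 = 0"
      using norm_unit_diff[OF x y] cos_\<omega> by simp
    with px qy \<open>p \<noteq> q\<close> show False by simp
  qed
  obtain u where u: "norm u = 1" "u \<bullet> x = 0" and y_eq: "y = cos \<omega> *\<^sub>R x + sin \<omega> *\<^sub>R u"
  proof (cases "\<omega> = pi")
    case False
    then show ?thesis
      using unit_vector_polar[OF x y, unfolded \<omega>_eq] that \<omega> \<open>\<omega> \<noteq> 0\<close> by (metis order_le_less)
  next
    case True
    have "\<exists>t\<ge>a. t \<le> b \<and> central_angle c r p (C t) = pi / 2"
      using ab pi_gt_zero True central_angle_refl[OF r pq(1)]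
        continuous_on_central_angle[OF r pq(1) cont img]
      by (intro IVT') (auto simp: ends simp flip: \<omega>_def)
    then obtain t where t: "t \<in> {a..b}" "central_angle c r p (C t) = pi / 2"
      by auto
    define m where "m = direction c r (C t)"
    have m: "norm m = 1"
      unfolding m_def using norm_direction[OF r] img t by blast
    have "arccos (x \<bullet> m) = pi / 2"
      using t by (simp add: central_angle_def x_def m_def)
    then obtain u where u: "norm u = 1" "u \<bullet> x = 0"
      using unit_vector_polar[OF x m] pi_gt_zero by (smt (verit) field_sum_of_halves)
    have "(norm (x - (- y)))\<^sup>2 = 0"
      using norm_unit_diff[OF x, of "- y"] y cos_\<omega> True by simp
    then have "x = - y" by (simp add: eq_neg_iff_add_eq_0)
    then show ?thesis
      by (intro that[OF u]) (simp add: True)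
  qed
  have "q = great_circle_arc c r x u \<omega>"
    unfolding qy y_eq great_circle_arc_def ..
  from geodesic_length_le_great_circle_arc[OF geo r x u px this \<omega>(1)]
  show ?thesis
    unfolding \<omega>_def .
qed

text \<open>A strict triangle inequality at \<open>C s\<close> or \<open>C t\<close> would make the three pieces of \<open>C\<close> together
  longer than \<open>r \<angle>(p, q)\<close>.\<close>
lemma geodesic_central_angle_additive:
  fixes C :: "real \<Rightarrow> 'a::real_inner"
  assumes geo: "geodesic_from_to (sphere c r) p q a b C" and r: "r > 0" and "p \<noteq> q"
    and s: "a \<le> s" and st: "s \<le> t" and t: "t \<le> b"
  shows "central_angle c r p (C t) = central_angle c r p (C s) + central_angle c r (C s) (C t)"
proof -
  have ab: "a \<le> b" and cont: "continuous_on {a..b} C" and ends: "C a = p" "C b = q"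
    and img: "C ` {a..b} \<subseteq> sphere c r"
    using geo by (auto simp: geodesic_from_to_def curve_from_to_def)
  let ?A = "\<lambda>s t. central_angle c r (C s) (C t)"
  have unit: "norm (direction c r (C t)) = 1" if "t \<in> {a..b}" for t
    using norm_direction[OF r] img that by blast
  have nonneg: "0 \<le> ?A s t" if "s \<in> {a..b}" "t \<in> {a..b}" for s t
    unfolding central_angle_def by (rule arccos_inner_bounds(1)[OF unit unit, OF that])
  have triangle: "?A s t \<le> ?A s m + ?A m t"
    if "s \<in> {a..b}" "m \<in> {a..b}" "t \<in> {a..b}" for s m t
    unfolding central_angle_def by (rule arccos_triangle[OF unit unit unit, OF that])
  have lower: "ennreal (r * ?A s t) \<le> curve_length C s t" if "a \<le> s" "s \<le> t" "t \<le> b" for s t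
  proof (rule central_angle_le_curve_length[OF r \<open>s \<le> t\<close>])
    have sub: "{s..t} \<subseteq> {a..b}"
      using that by auto
    show "continuous_on {s..t} C"
      using cont sub by (rule continuous_on_subset)
    show "C ` {s..t} \<subseteq> sphere c r"
      using img sub by blast
  qed
  have pts: "a \<in> {a..b}" "s \<in> {a..b}" "t \<in> {a..b}" "b \<in> {a..b}"
    using s st t by auto
  have "ennreal (r * (?A a s + ?A s t + ?A t b))
      = ennreal (r * ?A a s) + ennreal (r * ?A s t) + ennreal (r * ?A t b)"
    using nonneg pts r by (simp add: distrib_left)
  also have "\<dots> \<le> curve_length C a s + curve_length C s t + curve_length C t b"
    using lower s st t by (intro add_mono) auto
  also have "\<dots> \<le> curve_length C a t + curve_length C t b"
    using curve_length_superadditive[OF s st, of C] by (intro add_mono) auto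
  also have "\<dots> \<le> curve_length C a b"
    using s st t by (intro curve_length_superadditive) auto
  also have "\<dots> \<le> ennreal (r * ?A a b)"
    using geodesic_length_le_central_angle[OF geo r \<open>p \<noteq> q\<close>] ends by simp
  finally have "?A a s + ?A s t + ?A t b \<le> ?A a b"
    using nonneg[of a b] pts r by simp
  moreover have "?A a b \<le> ?A a t + ?A t b" "?A a t \<le> ?A a s + ?A s t"
    using triangle pts by blast+
  ultimately show ?thesis
    using ends by simp
qed

text \<open>With \<open>m\<close> the half-way point and \<open>\<mu> = \<angle>(p, m) \<in> (0, \<pi>/2]\<close>, every point of the curve forms a
  degenerate triangle with \<open>p\<close> and \<open>m\<close>. Since \<open>sin \<mu> \<noteq> 0\<close>, the equality case expresses the point
  through \<open>p\<close> and \<open>m\<close>, hence in polar coordinates in their plane.\<close>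
lemma geodesic_imp_minor_arc:
  fixes C :: "real \<Rightarrow> 'a::real_inner"
  assumes geo: "geodesic_from_to (sphere c r) p q a b C" and r: "r > 0" and "p \<noteq> q"
  shows "minor_arc_from_to c r p q a b C"
proof -
  have ab: "a \<le> b" and cont: "continuous_on {a..b} C" and ends: "C a = p" "C b = q"
    and img: "C ` {a..b} \<subseteq> sphere c r"
    using geo by (auto simp: geodesic_from_to_def curve_from_to_def)
  have p: "p \<in> sphere c r"
    using image_subset_iff[THEN iffD1, OF img] ab ends by force
  define D where "D t = direction c r (C t)" for t
  have unit: "norm (D t) = 1" if "t \<in> {a..b}" for t
    unfolding D_def using norm_direction[OF r] img that by blast
  have C_eq: "C t = c + r *\<^sub>R D t" for t
    unfolding D_def by (rule eq_center_plus_direction[OF r])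
  define x where "x = D a"
  have x: "norm x = 1"
    using unit ab by (simp add: x_def)
  define \<theta> where "\<theta> t = arccos (x \<bullet> D t)" for t
  have \<theta>_angle: "\<theta> t = central_angle c r p (C t)" for t
    by (simp add: \<theta>_def x_def D_def central_angle_def ends)
  have \<theta>_bounds: "0 \<le> \<theta> t" "\<theta> t \<le> pi" if "t \<in> {a..b}" for t
    unfolding \<theta>_def by (rule arccos_inner_bounds[OF x unit, OF that])+
  have additive: "\<theta> t = \<theta> s + arccos (D s \<bullet> D t)" if "a \<le> s" "s \<le> t" "t \<le> b" for s t
    using geodesic_central_angle_additive[OF geo r \<open>p \<noteq> q\<close> that]
    by (simp add: \<theta>_angle D_def central_angle_def)
  have mono: "mono_on {a..b} \<theta>"
  proof (rule mono_onI)
    fix s t assume st: "s \<in> {a..b}" "t \<in> {a..b}" "s \<le> t"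
    then show "\<theta> s \<le> \<theta> t"
      using additive[of s t] arccos_inner_bounds(1)[OF unit unit, OF st(1,2)] by simp
  qed
  have cont_\<theta>: "continuous_on {a..b} \<theta>"
    unfolding \<theta>_angle by (rule continuous_on_central_angle[OF r p cont img])
  define \<omega> where "\<omega> = \<theta> b"
  have \<theta>a: "\<theta> a = 0"
    using central_angle_refl[OF r p] by (simp add: \<theta>_angle ends)
  have \<omega>: "0 \<le> \<omega>" "\<omega> \<le> pi"
    using \<theta>_bounds ab by (simp_all add: \<omega>_def)
  have range_\<theta>: "\<theta> ` {a..b} = {0..\<omega>}"
  proof
    show "\<theta> ` {a..b} \<subseteq> {0..\<omega>}"
      using \<theta>_bounds(1) mono_onD[OF mono, of _ b] ab by (auto simp: \<omega>_def)
    show "{0..\<omega>} \<subseteq> \<theta> ` {a..b}"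
    proof
      fix v assume "v \<in> {0..\<omega>}"
      then show "v \<in> \<theta> ` {a..b}"
        using IVT'[of \<theta> a v b] \<theta>a ab cont_\<theta> by (auto simp: \<omega>_def)
    qed
  qed
  have "\<omega> \<noteq> 0"
  proof
    assume "\<omega> = 0"
    then have "x \<bullet> D b = 1"
      using cos_arccos_inner[OF x unit[of b]] ab by (simp add: \<omega>_def \<theta>_def)
    then have "(norm (x - D b))\<^sup>2 = 0"
      using norm_unit_diff[OF x unit[of b]] ab by simp
    then show False
      using C_eq[of a] C_eq[of b] ends \<open>p \<noteq> q\<close> by (simp add: x_def)
  qed
  have "\<omega> / 2 \<in> \<theta> ` {a..b}"
    unfolding range_\<theta> using \<omega> by simp
  then obtain m where m: "m \<in> {a..b}" and \<theta>m: "\<theta> m = \<omega> / 2"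
    by (metis imageE)
  define \<mu> where "\<mu> = \<theta> m"
  have \<mu>: "0 < \<mu>" "\<mu> < pi"
    using \<omega> \<open>\<omega> \<noteq> 0\<close> pi_gt_zero by (simp_all add: \<mu>_def \<theta>m)
  then have sin_\<mu>: "sin \<mu> > 0"
    by (intro sin_gt_zero)
  have "0 < arccos (x \<bullet> D m)" "arccos (x \<bullet> D m) < pi"
    using \<mu> by (simp_all add: \<mu>_def \<theta>_def)
  then obtain u where u: "norm u = 1" "u \<bullet> x = 0"
    and "D m = cos (arccos (x \<bullet> D m)) *\<^sub>R x + sin (arccos (x \<bullet> D m)) *\<^sub>R u"
    by (rule unit_vector_polar[OF x unit[OF m]])
  then have Dm: "D m = cos \<mu> *\<^sub>R x + sin \<mu> *\<^sub>R u"
    by (simp add: \<mu>_def \<theta>_def)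
  have D_eq: "D t = cos (\<theta> t) *\<^sub>R x + sin (\<theta> t) *\<^sub>R u" if t: "t \<in> {a..b}" for t
  proof -
    \<comment> \<open>Both orders of \<open>t\<close> and \<open>m\<close> give the same relation, solved for \<open>D t\<close>.\<close>
    have "sin \<mu> *\<^sub>R D t = sin (\<mu> - \<theta> t) *\<^sub>R x + sin (\<theta> t) *\<^sub>R D m"
    proof (cases "t \<le> m")
      case True
      have "arccos (D t \<bullet> D m) = \<mu> - \<theta> t"
        using additive[of t m] True t m by (simp add: \<mu>_def)
      then show ?thesis
        using arccos_triangle_equality[OF x unit[OF t] unit[OF m] \<theta>_def[symmetric]]
        by (simp add: add.commute flip: \<mu>_def \<theta>_def)
    next
      case False
      have "arccos (D m \<bullet> D t) = \<theta> t - \<mu>"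
        using additive[of m t] False t m by (simp add: \<mu>_def)
      then have "sin (\<theta> t - \<mu>) *\<^sub>R x + sin \<mu> *\<^sub>R D t = sin (\<theta> t) *\<^sub>R D m"
        using arccos_triangle_equality[OF x unit[OF m] unit[OF t] \<theta>_def[symmetric]]
        by (simp flip: \<mu>_def \<theta>_def)
      moreover have "sin (\<theta> t - \<mu>) = - sin (\<mu> - \<theta> t)"
        by (simp flip: sin_minus)
      ultimately show ?thesis
        by (simp add: algebra_simps)
    qed
    also have "\<dots> = sin \<mu> *\<^sub>R (cos (\<theta> t) *\<^sub>R x + sin (\<theta> t) *\<^sub>R u)"
      by (simp add: Dm sin_diff algebra_simps)
    finally show ?thesis
      using sin_\<mu> by simp
  qed
  have pc: "p - c = r *\<^sub>R x"
    using C_eq[of a] ends by (simp add: x_def)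
  show ?thesis
    unfolding minor_arc_from_to_def
  proof (intro exI[of _ u] exI[of _ \<omega>] exI[of _ \<theta>] conjI ballI)
    show "orthogonal u (p - c)"
      using u by (simp add: orthogonal_def pc)
    show "C t = c + cos (\<theta> t) *\<^sub>R (p - c) + (r * sin (\<theta> t)) *\<^sub>R u" if "t \<in> {a..b}" for t
      using C_eq[of t] D_eq[OF that] by (simp add: pc algebra_simps)
    show "\<omega> \<in> {0..pi}"
      using \<omega> by simp
  qed (use u cont_\<theta> mono range_\<theta> ends in simp_all)
qed

theorem theorem2:
  fixes c p q :: "'a::real_inner" and r a b :: real and C :: "real \<Rightarrow> 'a"
  assumes "r > 0"
    and "p \<in> sphere c r" and "q \<in> sphere c r"
    and "a < b"
    and "continuous_on {a..b} C" and "C a = p" and "C b = q" and "C ` {a..b} \<subseteq> sphere c r"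
    and "\<And>s t. a \<le> s \<Longrightarrow> s < t \<Longrightarrow> t \<le> b \<Longrightarrow> curve_length C s t > 0"
    and "\<not> minor_arc_from_to c r p q a b C"
  shows "\<not> geodesic_from_to (sphere c r) p q a b C"
proof
  assume geo: "geodesic_from_to (sphere c r) p q a b C"
  have "p \<noteq> q"
  proof
    assume "p = q"
    then have "curve_length C a b = 0"
      using geo geodesic_loop_length by blast
    with assms(9)[of a b] \<open>a < b\<close> show False by simp
  qed
  with geodesic_imp_minor_arc[OF geo \<open>r > 0\<close>] assms(10) show False by blast
qed

end
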